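(* Let $g:\mathbb{R}^+\to\mathbb{R}^+$ be a function such that $\frac{g(n+1)}{g(n)}\to 1$ as $n\to\infty$ ($n$ ranging over positive integers). Suppose that $f:\mathbb{R}^+\to\mathbb{R}^+$ is an eventually $\log$-convex function satisfying $f(x+1)=g(x)f(x)$ for all $x>0$ and $f(1)=1$. Then $f$ is uniquely determined by $g$ through the equation $$f(x)=\lim_{n\to\infty}\frac{g(n)\cdots g(1)\,g(n)^x}{g(n+x)\,g(n+x-1)\cdots g(x)}\qquad\text{for all } x>0,$$ that is, for every $x>0$ the limit exists and equals $f(x)$.
   Context: $\mathbb{R}^+=(0,\infty)$. A function $f:\mathbb{R}^+\to\mathbb{R}^+$ is eventually $\log$-convex if there is a number $M$ such that $\log f$ is convex on $(M,\infty)$. The numerator is $g(n)^x\prod_{k=1}^n g(k)$ and the denominator is $\prod_{k=0}^{n} g(x+k)$. *)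

theory Defs
  imports "HOL-Analysis.Analysis"
begin

(* Functions from (0, \<infinity>) to (0, \<infinity>) are modelled as total functions on the reals of which
   only the values on {0<..} matter. Accordingly the threshold M is taken to be nonnegative, so that
   {M<..} lies in the domain; for f defined on (0, \<infinity>) only, this is no restriction on M. *)
definition eventually_log_convex :: "(real \<Rightarrow> real) \<Rightarrow> bool" where
  "eventually_log_convex f \<longleftrightarrow> (\<exists>M\<ge>0. convex_on {M<..} (\<lambda>x. ln (f x)))"

end

theory Submission
  imports Defs
begin

text \<open>
  The functional equation turns the \<open>n\<close>-th term of the sequence into
  \<open>f x * (f (n + 1) * g n powr x / f (n + 1 + x))\<close>. Put \<open>L = ln \<circ> f\<close>; then
  \<open>L (n + 1) - L n = ln (g n)\<close>, and comparing the slopes of the convex function \<open>L\<close> over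
  \<open>[n, n + 1]\<close>, \<open>[n + 1, n + 1 + x]\<close> and \<open>[n + m, n + m + 1]\<close>, where \<open>m \<ge> x + 1\<close>, squeezes
  \<open>L (n + 1 + x) - L (n + 1) - x * ln (g n)\<close> between \<open>0\<close> and \<open>x * (ln (g (n + m)) - ln (g n))\<close>,
  which tends to \<open>0\<close> because \<open>g (n + 1) / g n\<close> tends to \<open>1\<close>.
\<close>

text \<open>Both slopes are compared with the slope over the whole interval from \<open>a\<close> to
  \<open>d\<close>. Allowing \<open>b = c\<close> covers adjacent intervals.\<close>

lemma convex_on_slope_mono:
  fixes h :: "real \<Rightarrow> real"
  assumes h: "convex_on S h" and S: "a \<in> S" "d \<in> S" and le: "a < b" "b \<le> c" "c < d"
  shows "(h b - h a) / (b - a) \<le> (h d - h c) / (d - c)"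
proof -
  have swap: "(h u - h v) / (u - v) = (h v - h u) / (v - u)" for u v
    by (metis minus_diff_eq minus_divide_divide)
  have "(h b - h a) / (b - a) \<le> (h d - h a) / (d - a)"
    using convex_on_slope_le(1)[OF h S, of b] le unfolding swap[of a b] swap[of a d] by linarith
  also have "\<dots> \<le> (h d - h c) / (d - c)"
    using convex_on_slope_le(2)[OF h S, of c] le unfolding swap[of a d] swap[of c d] by linarith
  finally show ?thesis .
qed

text \<open>The difference telescopes into \<open>m\<close> consecutive differences, with
  \<open>m\<close> fixed, each a shifted copy of the null sequence.\<close>

lemma LIMSEQ_diff_shift:
  fixes s :: "nat \<Rightarrow> real"
  assumes "(\<lambda>n. s (Suc n) - s n) \<longlonglongrightarrow> 0"
  shows "(\<lambda>n. s (n + m) - s n) \<longlonglongrightarrow> 0"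
proof (induction m)
  case (Suc m)
  have "(\<lambda>n. s (Suc (n + m)) - s (n + m)) \<longlonglongrightarrow> 0"
    using LIMSEQ_ignore_initial_segment[OF assms, of m] by simp
  from tendsto_add[OF this Suc] show ?case
    by simp
qed simp

lemma prod_shift_functional_equation:
  fixes f g :: "real \<Rightarrow> real"
  assumes "\<And>x. x > 0 \<Longrightarrow> f (x + 1) = g x * f x" and "x > 0"
  shows "f (x + real n) = (\<Prod>k<n. g (x + real k)) * f x"
proof (induction n)
  case (Suc n)
  have "f (x + real n + 1) = g (x + real n) * f (x + real n)"
    using assms by simp
  with Suc show ?case
    by (simp add: algebra_simps)
qed simp

theorem lemma2p1:
  fixes f g :: "real \<Rightarrow> real"
  assumes g_pos: "\<And>x. x > 0 \<Longrightarrow> g x > 0"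
    and g_ratio: "(\<lambda>n::nat. g (real n + 1) / g (real n)) \<longlonglongrightarrow> 1"
    and f_pos: "\<And>x. x > 0 \<Longrightarrow> f x > 0"
    and f_conv: "eventually_log_convex f"
    and f_eq: "\<And>x. x > 0 \<Longrightarrow> f (x + 1) = g x * f x"
    and f_one: "f 1 = 1"
  shows "\<forall>x>0. (\<lambda>n::nat. ((\<Prod>k=1..n. g (real k)) * g (real n) powr x)
                        / (\<Prod>k=0..n. g (x + real k))) \<longlonglongrightarrow> f x"
proof (intro allI impI)
  fix x :: real
  assume x: "x > 0"
  obtain M where M: "M \<ge> 0" "convex_on {M<..} (\<lambda>x. ln (f x))"
    using f_conv unfolding eventually_log_convex_def by blast
  define s where "s = (\<lambda>n::nat. ln (g (real n)))"
  \<comment> \<open>Chosen so that for \<open>n > 0\<close> the \<open>n\<close>-th term of the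
    sequence is \<open>f x * exp (- D n)\<close>; it remains to show that \<open>D\<close> tends to
    \<open>0\<close>.\<close>
  define D where "D = (\<lambda>n::nat. ln (f (real n + 1 + x)) - ln (f (real n + 1)) - x * s n)"
  have ln_step: "ln (f (y + 1)) - ln (f y) = ln (g y)" if "y > 0" for y
    using that f_eq g_pos f_pos by (simp add: ln_mult_pos)
  \<comment> \<open>Then \<open>n + 1 + x \<le> n + m\<close> for every \<open>n\<close>, with
    \<open>m\<close> independent of \<open>n\<close>, as the telescoping limit requires.\<close>
  obtain m :: nat where m: "x + 1 \<le> real m"
    using real_arch_simple by blast
  have "(\<lambda>n. ln (g (real n + 1) / g (real n))) \<longlonglongrightarrow> 0"
    using tendsto_ln[OF g_ratio] by simp
  \<comment> \<open>Nothing is known about \<open>g 0\<close>, so the logarithm of the quotient is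
    split only for \<open>n > 0\<close>.\<close>
  moreover have "\<forall>\<^sub>F n in sequentially. ln (g (real n + 1) / g (real n)) = s (Suc n) - s n"
    using eventually_gt_at_top[of 0]
    by eventually_elim (simp add: s_def ln_div g_pos add.commute less_imp_neq[THEN not_sym])
  ultimately have "(\<lambda>n. s (Suc n) - s n) \<longlonglongrightarrow> 0"
    by (rule Lim_transform_eventually)
  then have bound: "(\<lambda>n. x * (s (n + m) - s n)) \<longlonglongrightarrow> 0"
    using LIMSEQ_diff_shift tendsto_mult_right_zero by blast
  \<comment> \<open>Once \<open>n > M\<close>, all points compared lie in the region of convexity,
    and \<open>M \<ge> 0\<close> makes \<open>n\<close> positive.\<close>
  have slope: "\<forall>\<^sub>F n in sequentially. 0 \<le> D n \<and> D n \<le> x * (s (n + m) - s n)"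
    using eventually_gt_at_top[of "nat \<lceil>M\<rceil>"]
  proof eventually_elim
    case (elim n)
    then have n: "real n > M"
      by linarith
    then have n0: "real n > 0"
      using M by linarith
    have "s n \<le> (ln (f (real n + 1 + x)) - ln (f (real n + 1))) / x"
      using convex_on_slope_mono[OF M(2), of "real n" "real n + 1 + x" "real n + 1" "real n + 1"]
        ln_step[OF n0] n x by (simp add: s_def)
    moreover have "(ln (f (real n + 1 + x)) - ln (f (real n + 1))) / x \<le> s (n + m)"
      using convex_on_slope_mono[OF M(2), of "real n + 1" "real (n + m) + 1" "real n + 1 + x" "real (n + m)"]
        ln_step[of "real (n + m)"] n n0 x m by (simp add: s_def)
    ultimately show ?case
      using x by (simp add: D_def field_simps)
  qed
  have "D \<longlonglongrightarrow> 0"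
  proof (rule tendsto_sandwich[OF _ _ tendsto_const bound])
    show "\<forall>\<^sub>F n in sequentially. 0 \<le> D n"
      using slope by (rule eventually_mono) simp
    show "\<forall>\<^sub>F n in sequentially. D n \<le> x * (s (n + m) - s n)"
      using slope by (rule eventually_mono) simp
  qed
  then have "(\<lambda>n. f x * exp (- D n)) \<longlonglongrightarrow> f x * exp (- 0)"
    by (intro tendsto_intros)
  moreover have "\<forall>\<^sub>F n in sequentially. f x * exp (- D n) =
      ((\<Prod>k=1..n. g (real k)) * g (real n) powr x) / (\<Prod>k=0..n. g (x + real k))"
    using eventually_gt_at_top[of 0]
  proof eventually_elim
    case (elim n)
    have "(\<Prod>k=1..n. g (real k)) = (\<Prod>k<n. g (1 + real k))"
      by (rule prod.reindex_bij_witness[of _ Suc "\<lambda>k. k - 1"]) auto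
    then have num: "(\<Prod>k=1..n. g (real k)) = f (real n + 1)"
      using prod_shift_functional_equation[of f g 1 n] f_eq f_one by (simp add: add.commute)
    \<comment> \<open>The product from \<open>0\<close> to \<open>n\<close> has \<open>n + 1\<close>
      factors, one more than the numerator, hence \<open>Suc n\<close>; the extra factor
      \<open>f x\<close> is the limit.\<close>
    have den: "f (real n + 1 + x) = (\<Prod>k=0..n. g (x + real k)) * f x"
      using prod_shift_functional_equation[of f g x "Suc n"] f_eq x
      by (simp add: add_ac atLeast0AtMost lessThan_Suc_atMost)
    have pos: "(\<Prod>k=0..n. g (x + real k)) > 0"
      using x by (intro prod_pos g_pos) auto
    have "exp (- D n) = f (real n + 1) * g (real n) powr x / f (real n + 1 + x)"
      using elim x f_pos g_pos
      by (simp add: D_def s_def exp_diff exp_add powr_def less_imp_neq[THEN not_sym])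
    then show ?case
      using pos f_pos[OF x] unfolding num den by simp
  qed
  ultimately show "(\<lambda>n::nat. ((\<Prod>k=1..n. g (real k)) * g (real n) powr x)
                        / (\<Prod>k=0..n. g (x + real k))) \<longlonglongrightarrow> f x"
    by (simp add: Lim_transform_eventually)
qed

end
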